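(* Let $e^{\rm cusp}_r$ be the order-$r$ SOS relaxation error of the bivariate problem $$\min_{(x_1,x_2)\in\mathbb{R}^2} x_1\quad\text{s.t.}\quad x_1^3-x_2^2\ge 0,\ \ 1-x_1\ge 0,$$ and let $e''_r$ be the order-$r$ SOS relaxation error of the univariate problem $$\min_{x\in\mathbb{R}} x\quad\text{s.t.}\quad x^3\ge 0,\ \ 1-x\ge 0 .$$ Then for every integer $r\ge 2$ the order-$r$ SOS relaxation values of the two problems coincide, i.e. $$e^{\rm cusp}_r=e''_r .$$
   Context: For a set of real variables $x$ (one or two variables), $\Sigma[x]$ denotes the cone of sums of squares of real polynomials in these variables. For polynomials $p_1,\ldots,p_k\in\mathbb{R}[x]$ and $p_0:=1$, the truncated quadratic module is $$\mathcal{Q}_r(p_1,\ldots,p_k):=\Big\{\sum_{i=0}^{k}\sigma_i p_i :\ \sigma_i\in\Sigma[x],\ \deg(\sigma_i p_i)\le 2r\Big\},$$ where $\deg$ is total degree and the zero polynomial is regarded as satisfying every degree bound. For a problem $\min f$ s.t. $p_1\ge0,\ldots,p_k\ge 0$ with minimum value $f^*$, the order-$r$ SOS relaxation value is $f_r:=\sup\{v\in\mathbb{R}: f-v\in\mathcal{Q}_r(p_1,\ldots,p_k)\}$ and the order-$r$ relaxation error is $f^*-f_r$. Both problems in the claim have minimum value $0$. *)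

theory Defs
  imports Complex_Main "HOL-Computational_Algebra.Polynomial" "HOL-Library.Extended_Real"
begin

text \<open>
  Univariate polynomials are \<^typ>\<open>real poly\<close>. Bivariate polynomials are
  \<^typ>\<open>real poly poly\<close>: the inner variable is \<open>x\<^sub>1\<close>, the outer one is \<open>x\<^sub>2\<close>, so
  \<open>coeff (coeff p j) i\<close> is the coefficient of \<open>x\<^sub>1\<^sup>i x\<^sub>2\<^sup>j\<close> in \<open>p\<close>.
\<close>

definition X1 :: "real poly poly" where
  "X1 = [:[:0, 1:]:]"

definition X2 :: "real poly poly" where
  "X2 = [:0, 1:]"

definition const2 :: "real \<Rightarrow> real poly poly" where
  "const2 v = [:[:v:]:]"

definition eval2 :: "real poly poly \<Rightarrow> real \<times> real \<Rightarrow> real" where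
  "eval2 p x = poly (poly p [:snd x:]) (fst x)"

definition total_degree :: "real poly poly \<Rightarrow> nat" where
  "total_degree p = Max (insert 0 {i + j | i j. coeff (coeff p j) i \<noteq> 0})"

lemma finite_monomial_degrees:
  fixes p :: "real poly poly"
  shows "finite {i + j | i j. coeff (coeff p j) i \<noteq> 0}"
proof (rule finite_subset)
  show "{i + j | i j. coeff (coeff p j) i \<noteq> 0}
      \<subseteq> (\<Union>j\<in>{..degree p}. (\<lambda>i. i + j) ` {..degree (coeff p j)})"
  proof
    fix n assume "n \<in> {i + j | i j. coeff (coeff p j) i \<noteq> 0}"
    then obtain i j where ij: "n = i + j" "coeff (coeff p j) i \<noteq> 0" by blast
    then have "coeff p j \<noteq> 0" by auto
    then have "j \<le> degree p" by (rule le_degree)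
    moreover from ij(2) have "i \<le> degree (coeff p j)" by (rule le_degree)
    ultimately show "n \<in> (\<Union>j\<in>{..degree p}. (\<lambda>i. i + j) ` {..degree (coeff p j)})"
      using ij(1) by auto
  qed
qed simp

lemma total_degree_le_iff:
  "total_degree p \<le> d \<longleftrightarrow> (\<forall>i j. coeff (coeff p j) i \<noteq> 0 \<longrightarrow> i + j \<le> d)"
  unfolding total_degree_def using finite_monomial_degrees[of p] by (subst Max_le_iff) auto

lemma total_degree_0: "total_degree 0 = 0"
  by (simp add: total_degree_def)

lemma eval2_simps:
  "eval2 X1 (a, b) = a" "eval2 X2 (a, b) = b" "eval2 (const2 v) (a, b) = v"
  "eval2 1 (a, b) = 1"
  "eval2 (p + q) (a, b) = eval2 p (a, b) + eval2 q (a, b)"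
  "eval2 (p - q) (a, b) = eval2 p (a, b) - eval2 q (a, b)"
  "eval2 (p * q) (a, b) = eval2 p (a, b) * eval2 q (a, b)"
  "eval2 (p ^ n) (a, b) = eval2 p (a, b) ^ n"
  by (simp_all add: eval2_def X1_def X2_def const2_def)

definition sos :: "'a::comm_ring_1 set" where
  "sos = {\<Sum>q\<leftarrow>qs. q ^ 2 | qs. True}"

text \<open>
  The notions below are shared by the univariate and the bivariate case. Their parameters
  are the degree function \<open>deg\<close>, the embedding \<open>const\<close> of the reals as constant
  polynomials, and the evaluation \<open>ev\<close> of a polynomial at a point. Both degree functions
  used here assign 0 to the zero polynomial, so it satisfies every degree bound.
\<close>

definition quadratic_module ::
    "('a::comm_ring_1 \<Rightarrow> nat) \<Rightarrow> nat \<Rightarrow> 'a list \<Rightarrow> 'a set" where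
  "quadratic_module deg r ps =
    {\<Sum>i\<le>length ps. \<sigma> i * (1 # ps) ! i | \<sigma>.
       \<forall>i\<le>length ps. \<sigma> i \<in> sos \<and> deg (\<sigma> i * (1 # ps) ! i) \<le> 2 * r}"

text \<open>Suprema and infima are taken in \<^typ>\<open>ereal\<close>, so that no convention is hidden in
  the case of an empty or unbounded set.\<close>

definition sos_value ::
    "('a::comm_ring_1 \<Rightarrow> nat) \<Rightarrow> (real \<Rightarrow> 'a) \<Rightarrow> 'a \<Rightarrow> 'a list \<Rightarrow> nat \<Rightarrow> ereal" where
  "sos_value deg const f ps r = (SUP v\<in>{v. f - const v \<in> quadratic_module deg r ps}. ereal v)"

definition min_value :: "('a \<Rightarrow> 'b \<Rightarrow> real) \<Rightarrow> 'a \<Rightarrow> 'a list \<Rightarrow> ereal" where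
  "min_value ev f ps = (INF x\<in>{x. \<forall>p\<in>set ps. ev p x \<ge> 0}. ereal (ev f x))"

definition sos_error ::
    "('a::comm_ring_1 \<Rightarrow> nat) \<Rightarrow> (real \<Rightarrow> 'a) \<Rightarrow> ('a \<Rightarrow> 'b \<Rightarrow> real) \<Rightarrow> 'a \<Rightarrow> 'a list \<Rightarrow> nat \<Rightarrow> ereal"
  where
  "sos_error deg const ev f ps r = min_value ev f ps - sos_value deg const f ps r"

definition cusp_constraints :: "real poly poly list" where
  "cusp_constraints = [X1 ^ 3 - X2 ^ 2, 1 - X1]"

definition cusp_value :: "nat \<Rightarrow> ereal" where
  "cusp_value = sos_value total_degree const2 X1 cusp_constraints"

definition cusp_error :: "nat \<Rightarrow> ereal" where
  "cusp_error = sos_error total_degree const2 eval2 X1 cusp_constraints"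

definition X :: "real poly" where
  "X = [:0, 1:]"

definition cubic_constraints :: "real poly list" where
  "cubic_constraints = [X ^ 3, 1 - X]"

definition cubic_value :: "nat \<Rightarrow> ereal" where
  "cubic_value = sos_value degree (\<lambda>v. [:v:]) X cubic_constraints"

definition cubic_error :: "nat \<Rightarrow> ereal" where
  "cubic_error = sos_error degree (\<lambda>v. [:v:]) poly X cubic_constraints"

end

theory Submission imports Defs begin

text \<open>
  The order-\<open>r\<close> certificates of the two problems can be converted into each other without
  changing the bound \<open>v\<close>. Restricting a bivariate certificate to the axis \<open>x\<^sub>2 = 0\<close> is a ring
  homomorphism which preserves sums of squares, does not raise the degree, and sends the
  cusp constraint \<open>x\<^sub>1\<^sup>3 - x\<^sub>2\<^sup>2\<close> to \<open>x\<^sup>3\<close>. Conversely, a univariate certificate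
  \<open>x - v = \<sigma>\<^sub>0 + \<sigma>\<^sub>1 x\<^sup>3 + \<sigma>\<^sub>2 (1 - x)\<close> becomes, in the variables \<open>x\<^sub>1, x\<^sub>2\<close>,
  \<open>x\<^sub>1 - v = (\<sigma>\<^sub>0 + \<sigma>\<^sub>1 x\<^sub>2\<^sup>2) + \<sigma>\<^sub>1 (x\<^sub>1\<^sup>3 - x\<^sub>2\<^sup>2) + \<sigma>\<^sub>2 (1 - x\<^sub>1)\<close>,
  where the new term \<open>\<sigma>\<^sub>1 x\<^sub>2\<^sup>2\<close> is again a sum of squares, of degree less than that of
  \<open>\<sigma>\<^sub>1 x\<^sup>3\<close> unless \<open>\<sigma>\<^sub>1 = 0\<close>.
  So the same \<open>v\<close> are certified in both problems. Both minima are \<open>0\<close>: on the cusp,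
  \<open>x\<^sub>1\<^sup>3 \<ge> x\<^sub>2\<^sup>2 \<ge> 0\<close> forces \<open>x\<^sub>1 \<ge> 0\<close>. Equal values and equal minima give equal errors.
\<close>

lemma sosI: "(\<Sum>q\<leftarrow>qs. q ^ 2) \<in> sos"
  by (auto simp: sos_def)

lemma sosE:
  assumes "s \<in> sos"
  obtains qs where "s = (\<Sum>q\<leftarrow>qs. q ^ 2)"
  using assms by (auto simp: sos_def)

lemma sos_add:
  assumes "s \<in> sos" "t \<in> sos"
  shows "s + t \<in> sos"
proof -
  obtain ps where "s = (\<Sum>q\<leftarrow>ps. q ^ 2)" using assms(1) by (rule sosE)
  moreover obtain qs where "t = (\<Sum>q\<leftarrow>qs. q ^ 2)" using assms(2) by (rule sosE)
  ultimately have "s + t = (\<Sum>q\<leftarrow>ps @ qs. q ^ 2)" by simp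
  then show ?thesis by (metis sosI)
qed

lemma sos_mult_square:
  assumes "s \<in> sos"
  shows "s * a ^ 2 \<in> sos"
proof -
  obtain qs where "s = (\<Sum>q\<leftarrow>qs. q ^ 2)" using assms by (rule sosE)
  then have "s * a ^ 2 = (\<Sum>q\<leftarrow>map (\<lambda>q. q * a) qs. q ^ 2)"
    by (simp add: sum_list_mult_const power_mult_distrib o_def)
  then show ?thesis by (metis sosI)
qed

lemma sos_hom:
  assumes "s \<in> sos" "h 0 = 0" "\<And>a b. h (a + b) = h a + h b" "\<And>a b. h (a * b) = h a * h b"
  shows "h s \<in> sos"
proof -
  obtain qs where s: "s = (\<Sum>q\<leftarrow>qs. q ^ 2)" using assms(1) by (rule sosE)
  have "h (\<Sum>q\<leftarrow>qs. q ^ 2) = (\<Sum>q\<leftarrow>map h qs. q ^ 2)"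
    by (induction qs) (simp_all add: assms(2-4) power2_eq_square)
  then show ?thesis by (metis s sosI)
qed

lemma quadratic_module_pair_iff:
  "p \<in> quadratic_module deg r [a, b] \<longleftrightarrow>
    (\<exists>s0 s1 s2. s0 \<in> sos \<and> s1 \<in> sos \<and> s2 \<in> sos \<and>
      deg s0 \<le> 2 * r \<and> deg (s1 * a) \<le> 2 * r \<and> deg (s2 * b) \<le> 2 * r \<and>
      p = s0 + s1 * a + s2 * b)" (is "?L \<longleftrightarrow> ?R")
proof
  have all: "(\<forall>i\<le>Suc (Suc 0). P i) \<longleftrightarrow> P 0 \<and> P (Suc 0) \<and> P (Suc (Suc 0))" for P
    by (auto simp: le_Suc_eq)
  {
    assume ?L
    then show ?R unfolding quadratic_module_def by (auto simp: all)
  next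
    assume ?R
    then obtain s0 s1 s2 where s: "s0 \<in> sos" "s1 \<in> sos" "s2 \<in> sos"
      "deg s0 \<le> 2 * r" "deg (s1 * a) \<le> 2 * r" "deg (s2 * b) \<le> 2 * r"
      "p = s0 + s1 * a + s2 * b" by blast
    then show ?L unfolding quadratic_module_def
      by (auto simp: all intro!: exI[of _ "\<lambda>i. [s0, s1, s2] ! i"])
  }
qed

lemma degree_restrict_le: "degree (poly p 0) \<le> total_degree p"
proof (rule degree_le, intro allI impI)
  fix i assume "total_degree p < i"
  then have "coeff (coeff p 0) i = 0"
    using total_degree_le_iff[of p "total_degree p"] by fastforce
  then show "coeff (poly p 0) i = 0" by (simp add: poly_0_coeff_0)
qed

text \<open>
  Polynomials \<open>a + c x\<^sub>2\<^sup>2\<close> with \<open>a\<close>, \<open>c\<close> in \<open>x\<^sub>1\<close> alone are the only ones with \<open>x\<^sub>2\<close> in them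
  that occur in a certificate lifted from one variable.
\<close>

lemma total_degree_even_quadratic_le:
  assumes "degree a \<le> d" "c = 0 \<or> degree c + 2 \<le> d"
  shows "total_degree [:a, 0, c:] \<le> d"
  unfolding total_degree_le_iff
proof (intro allI impI)
  fix i j assume nz: "coeff (coeff [:a, 0, c:] j) i \<noteq> 0"
  consider "j = 0" | "j = 1" | "j = 2" | k where "j = Suc (Suc (Suc k))"
    by (metis One_nat_def Suc_1 not0_implies_Suc)
  then show "i + j \<le> d"
  proof cases
    case 1
    then show ?thesis using nz assms(1) by (auto dest!: le_degree)
  next
    case 3
    then have "coeff c i \<noteq> 0" using nz by (simp add: numeral_2_eq_2)
    then show ?thesis using 3 assms(2) le_degree[of c i] by auto
  qed (use nz in simp_all)
qed

lemma total_degree_constant_le: "degree a \<le> d \<Longrightarrow> total_degree [:a:] \<le> d"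
  using total_degree_even_quadratic_le[of a d 0] by simp

text \<open>
  The degree bounds carry over to the bivariate certificate because leading terms cannot
  cancel in \<open>\<sigma>\<^sub>1 x\<^sup>3\<close>: unless \<open>\<sigma>\<^sub>1 = 0\<close>, its bound gives \<open>deg \<sigma>\<^sub>1 + 3 \<le> 2r\<close>, which leaves
  room for the factor \<open>x\<^sub>2\<^sup>2\<close> in both places where \<open>\<sigma>\<^sub>1 x\<^sub>2\<^sup>2\<close> occurs. In the other direction
  the bounds are inherited because restricting a product to \<open>x\<^sub>2 = 0\<close> only deletes monomials.
\<close>

lemma cubic_certificate_iff_cusp_certificate:
  "X - [:v:] \<in> quadratic_module degree r cubic_constraints \<longleftrightarrow>
    X1 - const2 v \<in> quadratic_module total_degree r cusp_constraints" (is "?U \<longleftrightarrow> ?B")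
proof
  assume ?U
  then obtain s0 s1 s2 where sos: "s0 \<in> sos" "s1 \<in> sos" "s2 \<in> sos"
    and deg: "degree s0 \<le> 2 * r" "degree (s1 * X ^ 3) \<le> 2 * r" "degree (s2 * (1 - X)) \<le> 2 * r"
    and eq: "X - [:v:] = s0 + s1 * X ^ 3 + s2 * (1 - X)"
    unfolding cubic_constraints_def quadratic_module_pair_iff by blast
  have lift: "[:s:] \<in> sos" if "s \<in> sos" for s :: "real poly"
    by (rule sos_hom[OF that]) simp_all
  have deg1: "s1 = 0 \<or> degree s1 + 3 \<le> 2 * r"
  proof (cases "s1 = 0")
    case False
    have "X \<noteq> 0" "degree X = 1" by (simp_all add: X_def)
    with False have "degree (s1 * X ^ 3) = degree s1 + 3"
      by (simp add: degree_mult_eq degree_power_eq)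
    then show ?thesis using deg(2) by simp
  qed simp
  have X1_X: "X1 = [:X:]" by (simp add: X1_def X_def)
  have X2_sq: "X2 ^ 2 = [:0, 0, 1:]" by (simp add: X2_def power2_eq_square)
  have cusp: "X1 ^ 3 - X2 ^ 2 = [:X ^ 3, 0, -1:]"
    by (simp add: X1_X X2_sq poly_const_pow)
  have "[:s0:] + [:s1:] * X2 ^ 2 = [:s0, 0, s1:]" by (simp add: X2_sq)
  then have "total_degree ([:s0:] + [:s1:] * X2 ^ 2) \<le> 2 * r"
    using deg(1) deg1 by (simp only:) (rule total_degree_even_quadratic_le, auto)
  moreover have "total_degree ([:s1:] * (X1 ^ 3 - X2 ^ 2)) \<le> 2 * r"
  proof -
    have "[:s1:] * (X1 ^ 3 - X2 ^ 2) = [:s1 * X ^ 3, 0, - s1:]"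
      unfolding cusp by simp
    then show ?thesis
      using deg(2) deg1 by (simp only:) (rule total_degree_even_quadratic_le, auto)
  qed
  moreover have "[:s2:] * (1 - X1) = [:s2 * (1 - X):]"
    by (simp add: X1_X one_pCons)
  then have "total_degree ([:s2:] * (1 - X1)) \<le> 2 * r"
    using deg(3) by (simp only: total_degree_constant_le)
  moreover have "X1 - const2 v =
      ([:s0:] + [:s1:] * X2 ^ 2) + [:s1:] * (X1 ^ 3 - X2 ^ 2) + [:s2:] * (1 - X1)"
  proof -
    have "X1 - const2 v = [:X - [:v:]:]" by (simp add: X1_X const2_def)
    also have "\<dots> = [:s0:] + [:s1:] * X1 ^ 3 + [:s2:] * (1 - X1)"
      unfolding eq by (simp add: X1_X poly_const_pow one_pCons)
    finally show ?thesis by (simp add: algebra_simps)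
  qed
  moreover have "[:s0:] + [:s1:] * X2 ^ 2 \<in> sos" "[:s1:] \<in> sos" "[:s2:] \<in> sos"
    by (intro sos_add sos_mult_square lift sos)+
  ultimately show ?B
    unfolding cusp_constraints_def quadratic_module_pair_iff by metis
next
  assume ?B
  then obtain t0 t1 t2 where sos: "t0 \<in> sos" "t1 \<in> sos" "t2 \<in> sos"
    and deg: "total_degree t0 \<le> 2 * r" "total_degree (t1 * (X1 ^ 3 - X2 ^ 2)) \<le> 2 * r"
      "total_degree (t2 * (1 - X1)) \<le> 2 * r"
    and eq: "X1 - const2 v = t0 + t1 * (X1 ^ 3 - X2 ^ 2) + t2 * (1 - X1)"
    unfolding cusp_constraints_def quadratic_module_pair_iff by blast
  have restrict: "poly t 0 \<in> sos" if "t \<in> sos" for t :: "real poly poly"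
    by (rule sos_hom[OF that]) simp_all
  have at_0: "poly X1 0 = X" "poly X2 0 = 0" "poly (const2 v) 0 = [:v:]"
    by (simp_all add: X1_def X2_def X_def const2_def)
  have "degree (poly t0 0) \<le> 2 * r" "degree (poly t1 0 * X ^ 3) \<le> 2 * r"
    "degree (poly t2 0 * (1 - X)) \<le> 2 * r"
    using deg[THEN order_trans[OF degree_restrict_le]] by (simp_all add: at_0)
  moreover have "X - [:v:] = poly t0 0 + poly t1 0 * X ^ 3 + poly t2 0 * (1 - X)"
    using arg_cong[OF eq, of "\<lambda>p. poly p 0"] by (simp add: at_0)
  ultimately show ?U
    unfolding cubic_constraints_def quadratic_module_pair_iff
    using sos[THEN restrict] by metis
qed

lemma cusp_value_eq_cubic_value: "cusp_value r = cubic_value r"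
  by (simp add: cusp_value_def cubic_value_def sos_value_def
      cubic_certificate_iff_cusp_certificate)

lemma min_value_eqI:
  assumes "\<And>p. p \<in> set ps \<Longrightarrow> ev p a \<ge> 0"
    and "\<And>x. \<forall>p\<in>set ps. ev p x \<ge> 0 \<Longrightarrow> ev f a \<le> ev f x"
  shows "min_value ev f ps = ereal (ev f a)"
  unfolding min_value_def using assms by (intro antisym INF_lower2[of a] INF_greatest) auto

lemma min_value_cubic: "min_value poly X cubic_constraints = 0"
proof -
  have "min_value poly X cubic_constraints = ereal (poly X 0)"
    by (rule min_value_eqI) (auto simp: cubic_constraints_def X_def zero_le_power_eq)
  then show ?thesis by (simp add: X_def zero_ereal_def)
qed

lemma min_value_cusp: "min_value eval2 X1 cusp_constraints = 0"
proof -
  have "0 \<le> a" if "b ^ 2 \<le> a ^ 3" for a b :: real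
  proof -
    have "0 \<le> a ^ 3" using that by (rule order_trans[OF zero_le_power2])
    then show ?thesis by (simp add: zero_le_power_eq)
  qed
  then have "min_value eval2 X1 cusp_constraints = ereal (eval2 X1 (0, 0))"
    by (intro min_value_eqI) (auto simp: cusp_constraints_def eval2_simps)
  then show ?thesis by (simp add: eval2_simps zero_ereal_def)
qed

theorem lemma13:
  fixes r :: nat
  assumes "r \<ge> 2"
  shows "cusp_value r = cubic_value r \<and> cusp_error r = cubic_error r"
proof
  show "cusp_value r = cubic_value r"
    by (rule cusp_value_eq_cubic_value)
  then show "cusp_error r = cubic_error r"
    unfolding cusp_error_def cubic_error_def sos_error_def
      cusp_value_def[symmetric] cubic_value_def[symmetric] min_value_cubic min_value_cusp
    by simp
qed

end
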